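(* Let $\Omega$ be a $C^2$ bounded or exterior domain in $\mathbf{R}^n$ such that each connected component of the boundary $\Gamma=\partial\Omega$ has a fully curved part. Let $R_*$ be the reach of $\Gamma$. Then for $\mu\in(0,\infty]$ and $\nu\in(0,R_* )$ the identity $$vBMO^{\mu,\nu}(\Omega)=vbmo^{\mu,\nu}_\nu(\Omega)$$ holds.
   Context: An exterior domain is a domain (connected open set) whose complement is compact and nonempty. The reach $R_*$ of $\Gamma$ is the supremum of $r>0$ such that every point at distance less than $r$ from $\Gamma$ has a unique nearest point on $\Gamma$. A connected component $\Gamma^0$ of $\Gamma$ has a fully curved part if the set $\{\mathbf{n}(x):x\in\Gamma^0\}$ of its unit exterior normals contains $n$ linearly independent vectors (spans $\mathbf{R}^n$). $d_\Omega(x)=\inf_{y\in\Gamma}|x-y|$ (Lipschitz, so $\nabla d_\Omega$ exists a.e. in $\Omega$); $\Gamma_\delta=\{x\in\Omega : d_\Omega(x)<\delta\}$; $B_r(x)$ is the closed ball; $f_B=\frac1{|B|}\int_Bf\,dy$. For $f\in L^1_{\mathrm{loc}}(\Omega)$, $\mu,\nu\in(0,\infty]$: $$[f]_{BMO^\mu}=\sup\Big\{\tfrac1{|B_r(x)|}\int_{B_r(x)}|f-f_{B_r(x)}|\,dy : B_r(x)\subset\Omega,\ r<\mu\Big\},$$ $$[f]_{b^\nu}=\sup\Big\{r^{-n}\int_{\Omega\cap B_r(x)}|f|\,dy : x\in\Gamma,\ 0<r<\nu\Big\}.$$ For a fixed $r_0>0$ (different choices give equivalent norms), $\|f\|_{L^1_{\mathrm{ul}}(D)}=\sup_{x\in\mathbf{R}^n}\int_{B_{r_0}(x)\cap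 D}|f|\,dy$. For vector fields these are taken componentwise. $vBMO^{\mu,\nu}(\Omega)$ is the space of vector fields $v\in L^1_{\mathrm{loc}}(\Omega)^n$ with $[v]_{BMO^\mu}+[\nabla d_\Omega\cdot v]_{b^\nu}<\infty$. $vbmo^{\mu,\nu}_\delta(\Omega)$ is the space of vector fields $v\in L^1_{\mathrm{loc}}(\Omega)^n$ with $[v]_{BMO^\mu}+\|v\|_{L^1_{\mathrm{ul}}(\Gamma_\delta)}+[\nabla d_\Omega\cdot v]_{b^\nu}<\infty$; here $\delta=\nu$. *)

theory Defs
  imports "HOL-Analysis.Analysis"
begin

definition bounded_domain :: "(real ^ 'n) set \<Rightarrow> bool" where
  "bounded_domain \<Omega> \<longleftrightarrow> open \<Omega> \<and> connected \<Omega> \<and> bounded \<Omega>"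

definition exterior_domain :: "(real ^ 'n) set \<Rightarrow> bool" where
  "exterior_domain \<Omega> \<longleftrightarrow> open \<Omega> \<and> connected \<Omega> \<and> compact (- \<Omega>) \<and> - \<Omega> \<noteq> {}"

text \<open>Meant for open \<open>S\<close>; \<open>g\<close> is the gradient and \<open>H\<close> the Hessian of \<open>f\<close>.\<close>
definition C2_on :: "(real ^ 'n) set \<Rightarrow> (real ^ 'n \<Rightarrow> real) \<Rightarrow> bool" where
  "C2_on S f \<longleftrightarrow> (\<exists>(g :: real ^ 'n \<Rightarrow> real ^ 'n) (H :: real ^ 'n \<Rightarrow> real ^ 'n ^ 'n).
     (\<forall>x\<in>S. GDERIV f x :> g x \<and> (g has_derivative (\<lambda>u. H x *v u)) (at x)) \<and>
     continuous_on S H)"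

text \<open>
  Near each boundary point \<open>x\<close>, in coordinates translated to \<open>x\<close> and rotated so that the last
  axis is \<open>e\<close>, the set \<open>\<Omega>\<close> lies above the graph of a \<open>C\<^sup>2\<close> function \<open>h\<close> on the disc of radius
  \<open>a\<close> in the hyperplane orthogonal to \<open>e\<close>, and the boundary is that graph. Only the values of
  \<open>h\<close> on the disc matter; a \<open>C\<^sup>2\<close> function on the disc is the restriction of one on the full
  ball (compose with the orthogonal projection), so regularity is required on the ball.
\<close>
definition C2_boundary :: "(real ^ 'n) set \<Rightarrow> bool" where
  "C2_boundary \<Omega> \<longleftrightarrow> (\<forall>x\<in>frontier \<Omega>. \<exists>e h a b.
     norm e = 1 \<and> 0 < a \<and> 0 < b \<and> C2_on (ball 0 a) h \<and> h 0 = 0 \<and>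
     (\<forall>y t. y \<bullet> e = 0 \<and> norm y < a \<and> \<bar>t\<bar> < b \<longrightarrow>
        (x + y + (h y + t) *\<^sub>R e \<in> \<Omega> \<longleftrightarrow> 0 < t) \<and>
        (x + y + (h y + t) *\<^sub>R e \<in> frontier \<Omega> \<longleftrightarrow> t = 0)))"

text \<open>Velocities at \<open>x\<close> of curves lying in \<open>\<Gamma>\<close>.\<close>
definition tangent_vectors :: "(real ^ 'n) set \<Rightarrow> real ^ 'n \<Rightarrow> (real ^ 'n) set" where
  "tangent_vectors \<Gamma> x = {w. \<exists>\<gamma>. \<gamma> 0 = x \<and> (\<gamma> has_vector_derivative w) (at 0) \<and>
     (\<forall>\<^sub>F t in at 0. \<gamma> t \<in> \<Gamma>)}"

definition is_unit_exterior_normal :: "(real ^ 'n) set \<Rightarrow> real ^ 'n \<Rightarrow> real ^ 'n \<Rightarrow> bool" where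
  "is_unit_exterior_normal \<Omega> x N \<longleftrightarrow> norm N = 1 \<and>
     (\<forall>w\<in>tangent_vectors (frontier \<Omega>) x. N \<bullet> w = 0) \<and>
     (\<forall>\<^sub>F t in at_right 0. x + t *\<^sub>R N \<notin> \<Omega>)"

definition fully_curved_part :: "(real ^ 'n) set \<Rightarrow> (real ^ 'n) set \<Rightarrow> bool" where
  "fully_curved_part \<Omega> \<Gamma>0 \<longleftrightarrow>
     (\<exists>B \<subseteq> {N. \<exists>x\<in>\<Gamma>0. is_unit_exterior_normal \<Omega> x N}. independent B \<and> card B = CARD('n))"

definition reach :: "(real ^ 'n) set \<Rightarrow> ereal" where
  "reach \<Gamma> = Sup {ereal r | r. 0 < r \<and>
     (\<forall>x. infdist x \<Gamma> < r \<longrightarrow> (\<exists>!y. y \<in> \<Gamma> \<and> dist x y = infdist x \<Gamma>))}"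

text \<open>
  Functions on \<open>\<Omega>\<close> are represented by functions on the whole space whose values outside \<open>\<Omega>\<close>
  are never used. Seminorms take values in \<open>[0,\<infinity>]\<close>.
\<close>

definition bdist :: "(real ^ 'n) set \<Rightarrow> real ^ 'n \<Rightarrow> real" where
  "bdist \<Omega> x = infdist x (frontier \<Omega>)"

definition bnbhd :: "(real ^ 'n) set \<Rightarrow> ereal \<Rightarrow> (real ^ 'n) set" where
  "bnbhd \<Omega> \<delta> = {x \<in> \<Omega>. ereal (bdist \<Omega> x) < \<delta>}"

text \<open>Unspecified at points where \<open>f\<close> is not differentiable.\<close>
definition grad :: "(real ^ 'n \<Rightarrow> real) \<Rightarrow> real ^ 'n \<Rightarrow> real ^ 'n" where
  "grad f x = (THE D. GDERIV f x :> D)"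

definition L1_loc :: "(real ^ 'n) set \<Rightarrow> (real ^ 'n \<Rightarrow> real) set" where
  "L1_loc \<Omega> = {f. \<forall>K. compact K \<and> K \<subseteq> \<Omega> \<longrightarrow> set_integrable lebesgue K f}"

definition mean :: "(real ^ 'n) set \<Rightarrow> (real ^ 'n \<Rightarrow> real) \<Rightarrow> real" where
  "mean B f = (LINT y:B|lebesgue. f y) / measure lebesgue B"

definition BMO_seminorm :: "ereal \<Rightarrow> (real ^ 'n) set \<Rightarrow> (real ^ 'n \<Rightarrow> real) \<Rightarrow> ennreal" where
  "BMO_seminorm \<mu> \<Omega> f =
     (SUP (x, r) \<in> {(x, r). 0 < r \<and> ereal r < \<mu> \<and> cball x r \<subseteq> \<Omega>}.
        (\<integral>\<^sup>+y\<in>cball x r. ennreal \<bar>f y - mean (cball x r) f\<bar> \<partial>lebesgue)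
          / emeasure lebesgue (cball x r))"

definition b_seminorm :: "ereal \<Rightarrow> (real ^ 'n) set \<Rightarrow> (real ^ 'n \<Rightarrow> real) \<Rightarrow> ennreal" where
  "b_seminorm \<nu> \<Omega> f =
     (SUP (x, r) \<in> {(x, r). x \<in> frontier \<Omega> \<and> 0 < r \<and> ereal r < \<nu>}.
        (\<integral>\<^sup>+y\<in>\<Omega> \<inter> cball x r. ennreal \<bar>f y\<bar> \<partial>lebesgue) / ennreal (r ^ CARD('n)))"

definition L1_ul_norm :: "real \<Rightarrow> (real ^ 'n) set \<Rightarrow> (real ^ 'n \<Rightarrow> real) \<Rightarrow> ennreal" where
  "L1_ul_norm r0 D f = (SUP x. \<integral>\<^sup>+y\<in>cball x r0 \<inter> D. ennreal \<bar>f y\<bar> \<partial>lebesgue)"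

definition vBMO :: "ereal \<Rightarrow> ereal \<Rightarrow> (real ^ 'n) set \<Rightarrow> (real ^ 'n \<Rightarrow> real ^ 'n) set" where
  "vBMO \<mu> \<nu> \<Omega> = {v. (\<forall>i. (\<lambda>x. v x $ i) \<in> L1_loc \<Omega>) \<and>
     (\<Sum>i\<in>UNIV. BMO_seminorm \<mu> \<Omega> (\<lambda>x. v x $ i))
       + b_seminorm \<nu> \<Omega> (\<lambda>x. grad (bdist \<Omega>) x \<bullet> v x) < \<infinity>}"

text \<open>\<open>r0\<close> is the fixed radius used in the uniformly local norm.\<close>
definition vbmo ::
  "real \<Rightarrow> ereal \<Rightarrow> ereal \<Rightarrow> ereal \<Rightarrow> (real ^ 'n) set \<Rightarrow> (real ^ 'n \<Rightarrow> real ^ 'n) set" where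
  "vbmo r0 \<mu> \<nu> \<delta> \<Omega> = {v. (\<forall>i. (\<lambda>x. v x $ i) \<in> L1_loc \<Omega>) \<and>
     (\<Sum>i\<in>UNIV. BMO_seminorm \<mu> \<Omega> (\<lambda>x. v x $ i))
       + (\<Sum>i\<in>UNIV. L1_ul_norm r0 (bnbhd \<Omega> \<delta>) (\<lambda>x. v x $ i))
       + b_seminorm \<nu> \<Omega> (\<lambda>x. grad (bdist \<Omega>) x \<bullet> v x) < \<infinity>}"

end

theory Submission
  imports Defs
begin

text \<open>
  Only \<open>vBMO \<subseteq> vbmo\<close> needs an argument, and since \<open>\<Gamma>\<^sub>\<nu>\<close> is bounded it suffices that a function of
  bounded mean oscillation on \<open>\<Omega>\<close> is integrable up to the boundary. In a boundary chart let \<open>t p\<close> be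
  the height of \<open>p\<close> above the graph. Moving \<open>p\<close> upwards by a fixed small proportion of \<open>t p\<close> changes
  the mean over the ball with centre \<open>p\<close> and radius comparable to \<open>t p\<close> by a bounded amount, so these
  means grow at most like \<open>log (1 / t p)\<close> as \<open>p\<close> approaches the boundary. The layer \<open>t \<approx> 2\<^sup>-\<^sup>k\<close> has
  measure \<open>O(2\<^sup>-\<^sup>k)\<close>, hence contributes \<open>O(k 2\<^sup>-\<^sup>k)\<close> to the integral, which is summable.
\<close>

section \<open>Integral inequalities for oscillations and ball averages\<close>

lemma unit_ball_vol_nonzero: "unit_ball_vol (real DIM('a::euclidean_space)) \<noteq> 0"
  by (metis less_irrefl of_nat_0_le_iff unit_ball_vol_pos)

lemma ennreal_mult_right_le_cancel:
  fixes a b c :: ennreal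
  assumes "a * c \<le> b * c" "0 < c" "c < \<infinity>"
  shows "a \<le> b"
  using assms ennreal_mult_le_mult_iff[of c a b] by (auto simp: mult.commute)

text \<open>Tonelli's theorem replaces a covering argument: integrate the bound over the centres
  \<open>p\<close> in \<open>P\<close> and exchange the integrals. Every \<open>q\<close> in
  \<open>Q\<close> is then counted with the volume of a ball of radius \<open>r\<close> as weight,
  because all centres within \<open>r\<close> of \<open>q\<close> lie in \<open>P\<close>.
  Cancelling this volume leaves the constant \<open>K\<close> unchanged.\<close>

lemma nn_integral_le_of_cball_bound:
  fixes f :: "'a::euclidean_space \<Rightarrow> ennreal"
  assumes [measurable]: "f \<in> borel_measurable borel" "P \<in> sets borel" "Q \<in> sets borel"
    and r: "0 < r" and QP: "\<And>q. q \<in> Q \<Longrightarrow> cball q r \<subseteq> P"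
    and bound: "\<And>p. p \<in> P \<Longrightarrow> (\<integral>\<^sup>+q\<in>cball p r. f q \<partial>lborel) \<le> K * emeasure lborel (cball p r)"
  shows "(\<integral>\<^sup>+q\<in>Q. f q \<partial>lborel) \<le> K * emeasure lborel P"
proof -
  define B where "B = emeasure lborel (cball (0::'a) r)"
  have B: "emeasure lborel (cball p r) = B" for p :: 'a
    using r by (simp add: B_def emeasure_cball)
  have B0: "0 < B" "B < \<infinity>"
    using r unit_ball_vol_nonzero[where 'a='a] by (simp_all add: B_def emeasure_cball)
  have "(\<integral>\<^sup>+q\<in>Q. f q \<partial>lborel) * B = (\<integral>\<^sup>+q. f q * indicator Q q * B \<partial>lborel)"
    by (simp add: nn_integral_multc)
  also have "\<dots> = (\<integral>\<^sup>+q. \<integral>\<^sup>+p. f q * indicator Q q * indicator {z. dist (fst z) (snd z) \<le> r} (q, p) \<partial>lborel \<partial>lborel)"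
  proof (rule nn_integral_cong)
    fix q :: 'a
    have "(\<integral>\<^sup>+p. f q * indicator Q q * indicator {z. dist (fst z) (snd z) \<le> r} (q, p) \<partial>lborel)
      = f q * indicator Q q * (\<integral>\<^sup>+p. indicator (cball q r) p \<partial>lborel)"
      by (subst nn_integral_cmult[symmetric])
        (measurable, auto intro!: nn_integral_cong simp: indicator_def)
    then show "f q * indicator Q q * B = (\<integral>\<^sup>+p. f q * indicator Q q * indicator {z. dist (fst z) (snd z) \<le> r} (q, p) \<partial>lborel)"
      by (simp add: B)
  qed
  also have "\<dots> = (\<integral>\<^sup>+p. \<integral>\<^sup>+q. f q * indicator Q q * indicator {z. dist (fst z) (snd z) \<le> r} (q, p) \<partial>lborel \<partial>lborel)"
    by (rule lborel_pair.Fubini') measurable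
  also have "\<dots> \<le> (\<integral>\<^sup>+p. K * B * indicator P p \<partial>lborel)"
  proof (rule nn_integral_mono)
    fix p :: 'a
    show "(\<integral>\<^sup>+q. f q * indicator Q q * indicator {z. dist (fst z) (snd z) \<le> r} (q, p) \<partial>lborel) \<le> K * B * indicator P p"
    proof (cases "p \<in> P")
      case True
      have "(\<integral>\<^sup>+q. f q * indicator Q q * indicator {z. dist (fst z) (snd z) \<le> r} (q, p) \<partial>lborel)
        \<le> (\<integral>\<^sup>+q\<in>cball p r. f q \<partial>lborel)"
        by (rule nn_integral_mono) (auto simp: indicator_def dist_commute)
      with bound[OF True] True B show ?thesis by simp
    next
      case False
      have "f q * indicator Q q * indicator {z. dist (fst z) (snd z) \<le> r} (q, p) = 0" for q
        using QP[of q] False by (auto simp: indicator_def subset_iff)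
      then show ?thesis by (simp only: mult_zero_right nn_integral_0_iff nn_integral_const) simp
    qed
  qed
  also have "\<dots> = K * emeasure lborel P * B"
    by (subst nn_integral_cmult_indicator) (auto simp: ac_simps)
  finally show ?thesis
    using B0 by (rule ennreal_mult_right_le_cancel)
qed

text \<open>The triangle inequality through \<open>f q\<close>, integrated over \<open>S\<close>.
  With \<open>S\<close> inside two balls it compares the constants that approximate \<open>f\<close>
  on them.\<close>

lemma const_diff_le_oscillation:
  fixes f :: "'a \<Rightarrow> real"
  assumes [measurable]: "f \<in> borel_measurable M" "S \<in> sets M"
  shows "ennreal \<bar>c - d\<bar> * emeasure M S
    \<le> (\<integral>\<^sup>+q\<in>S. ennreal \<bar>f q - c\<bar> \<partial>M) + (\<integral>\<^sup>+q\<in>S. ennreal \<bar>f q - d\<bar> \<partial>M)"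
proof -
  have "ennreal \<bar>c - d\<bar> * emeasure M S = (\<integral>\<^sup>+q. ennreal \<bar>c - d\<bar> * indicator S q \<partial>M)"
    by (simp add: nn_integral_cmult_indicator)
  also have "\<dots> \<le> (\<integral>\<^sup>+q. ennreal \<bar>f q - c\<bar> * indicator S q + ennreal \<bar>f q - d\<bar> * indicator S q \<partial>M)"
    by (intro nn_integral_mono) (auto simp: indicator_def ennreal_plus[symmetric] simp del: ennreal_plus intro!: ennreal_leI)
  also have "\<dots> = (\<integral>\<^sup>+q\<in>S. ennreal \<bar>f q - c\<bar> \<partial>M) + (\<integral>\<^sup>+q\<in>S. ennreal \<bar>f q - d\<bar> \<partial>M)"
    by (rule nn_integral_add) auto
  finally show ?thesis .
qed

lemma nn_integral_abs_le_oscillation: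
  fixes f :: "'a \<Rightarrow> real"
  assumes [measurable]: "f \<in> borel_measurable M" "S \<in> sets M"
  shows "(\<integral>\<^sup>+q\<in>S. ennreal \<bar>f q\<bar> \<partial>M)
    \<le> (\<integral>\<^sup>+q\<in>S. ennreal \<bar>f q - c\<bar> \<partial>M) + ennreal \<bar>c\<bar> * emeasure M S"
proof -
  have "(\<integral>\<^sup>+q\<in>S. ennreal \<bar>f q\<bar> \<partial>M)
     \<le> (\<integral>\<^sup>+q. ennreal \<bar>f q - c\<bar> * indicator S q + ennreal \<bar>c\<bar> * indicator S q \<partial>M)"
    by (intro nn_integral_mono) (auto simp: indicator_def ennreal_plus[symmetric] simp del: ennreal_plus intro!: ennreal_leI)
  also have "\<dots> = (\<integral>\<^sup>+q\<in>S. ennreal \<bar>f q - c\<bar> \<partial>M) + ennreal \<bar>c\<bar> * emeasure M S"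
    by (subst nn_integral_add) (auto simp: nn_integral_cmult_indicator)
  finally show ?thesis .
qed

lemma nn_set_integral_mono_set:
  fixes f :: "'a \<Rightarrow> ennreal"
  assumes "S \<subseteq> T"
  shows "(\<integral>\<^sup>+q\<in>S. f q \<partial>M) \<le> (\<integral>\<^sup>+q\<in>T. f q \<partial>M)"
  using assms by (intro nn_integral_mono) (auto simp: indicator_def)

section \<open>Heights above a Lipschitz graph and the slabs between level sets\<close>

text \<open>The zero set of \<open>t\<close> is a Lipschitz graph through \<open>x0\<close> in the
  direction \<open>e\<close>, and \<open>t\<close> is the signed vertical distance to it. As
  \<open>t\<close> is defined on the whole space, vertical translations and slabs need no
  restriction to a chart.\<close>

locale lipschitz_height =
  fixes e x0 :: "'a::euclidean_space" and t :: "'a \<Rightarrow> real" and \<Lambda> :: real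
  assumes norm_e: "norm e = 1"
    and height_shift: "\<And>p u. t (p + u *\<^sub>R e) = t p + u"
    and height_lipschitz: "\<And>p q. \<bar>t p - t q\<bar> \<le> \<Lambda> * dist p q"
    and height_base: "t x0 = 0"
begin

text \<open>The existential over \<open>u\<close> describes the vertical cylinder through the ball.
  This condition is invariant under translation along \<open>e\<close>, so such a translation
  changes only the heights.\<close>

definition slab :: "real \<Rightarrow> real \<Rightarrow> real \<Rightarrow> 'a set" where
  "slab \<rho> a b = {p. (\<exists>u. p + u *\<^sub>R e \<in> ball x0 \<rho>) \<and> a \<le> t p \<and> t p \<le> b}"

lemma Lambda_ge_1: "1 \<le> \<Lambda>"
  using height_lipschitz[of "x0 + 1 *\<^sub>R e" x0] height_shift[of x0 1] norm_e
  by (simp add: dist_norm)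

lemma height_continuous: "continuous_on A t"
proof (rule lipschitz_on_continuous_on)
  show "\<Lambda>-lipschitz_on A t"
    using height_lipschitz Lambda_ge_1 by (auto intro!: lipschitz_onI simp: dist_real_def)
qed

lemma height_measurable [measurable]: "t \<in> borel_measurable borel"
  by (rule borel_measurable_continuous_onI[OF height_continuous])

lemma slab_sets [measurable]: "slab \<rho> a b \<in> sets borel"
proof -
  have eq: "{p. \<exists>u. p + u *\<^sub>R e \<in> ball x0 \<rho>} = (\<Union>u. ball (x0 - u *\<^sub>R e) \<rho>)"
    by (auto simp: dist_norm algebra_simps)
  have "open {p. \<exists>u. p + u *\<^sub>R e \<in> ball x0 \<rho>}"
    unfolding eq by auto
  then have [measurable]: "{p. \<exists>u. p + u *\<^sub>R e \<in> ball x0 \<rho>} \<in> sets borel" by auto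
  have "slab \<rho> a b = {p. \<exists>u. p + u *\<^sub>R e \<in> ball x0 \<rho>} \<inter> {p \<in> space borel. a \<le> t p \<and> t p \<le> b}"
    by (auto simp: slab_def)
  also have "\<dots> \<in> sets borel" by measurable
  finally show ?thesis .
qed

lemma slab_mono:
  assumes "\<rho> \<le> \<rho>'" "a' \<le> a" "b \<le> b'"
  shows "slab \<rho> a b \<subseteq> slab \<rho>' a' b'"
  using assms by (fastforce simp: slab_def intro: less_le_trans)

text \<open>Heights inside the ball are at most \<open>\<Lambda> * \<rho>\<close> in absolute value,
  so the vertical move from \<open>p\<close> into the ball has length at most
  \<open>s + \<Lambda> * \<rho>\<close>.\<close>

lemma slab_dist_base:
  assumes "p \<in> slab \<rho> a b" "\<bar>t p\<bar> \<le> s"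
  shows "dist p x0 \<le> \<rho> + s + \<Lambda> * \<rho>"
proof -
  obtain u where u: "dist x0 (p + u *\<^sub>R e) < \<rho>" using assms(1) by (auto simp: slab_def)
  have "\<bar>t p + u\<bar> \<le> \<Lambda> * dist x0 (p + u *\<^sub>R e)"
    using height_lipschitz[of x0 "p + u *\<^sub>R e"] by (simp add: height_shift height_base)
  also have "\<dots> \<le> \<Lambda> * \<rho>" using u Lambda_ge_1 by (intro mult_left_mono) auto
  finally have "\<bar>u\<bar> \<le> s + \<Lambda> * \<rho>" using assms(2) by linarith
  moreover have "dist p (p + u *\<^sub>R e) = \<bar>u\<bar>" by (simp add: dist_norm norm_e)
  moreover have "dist p x0 \<le> dist p (p + u *\<^sub>R e) + dist x0 (p + u *\<^sub>R e)"
    by (metis dist_commute dist_triangle)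
  ultimately show ?thesis using u by linarith
qed

lemma cball_subset_slab:
  assumes p: "p \<in> slab \<rho> a b"
  shows "cball p d \<subseteq> slab (\<rho> + d) (a - \<Lambda> * d) (b + \<Lambda> * d)"
proof
  fix q assume q: "q \<in> cball p d"
  obtain u where u: "dist x0 (p + u *\<^sub>R e) < \<rho>" using p by (auto simp: slab_def)
  have "dist x0 (q + u *\<^sub>R e) \<le> dist x0 (p + u *\<^sub>R e) + dist (p + u *\<^sub>R e) (q + u *\<^sub>R e)"
    by (rule dist_triangle)
  also have "dist (p + u *\<^sub>R e) (q + u *\<^sub>R e) \<le> d" using q by (simp add: dist_norm)
  finally have "dist x0 (q + u *\<^sub>R e) < \<rho> + d" using u by linarith
  moreover have "\<bar>t p - t q\<bar> \<le> \<Lambda> * d"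
    using height_lipschitz[of p q] mult_left_mono[of "dist p q" d \<Lambda>] q Lambda_ge_1
    by (meson dist_commute le_less_trans linorder_not_le mem_cball order_trans zero_le_one)
  ultimately show "q \<in> slab (\<rho> + d) (a - \<Lambda> * d) (b + \<Lambda> * d)"
    using p by (auto simp: slab_def intro!: exI[of _ u])
qed

lemma slab_shift:
  assumes "p \<in> slab \<rho> a b"
  shows "p + v *\<^sub>R e \<in> slab \<rho> (a + v) (b + v)"
proof -
  obtain u where u: "p + u *\<^sub>R e \<in> ball x0 \<rho>" using assms by (auto simp: slab_def)
  have "p + v *\<^sub>R e + (u - v) *\<^sub>R e = p + u *\<^sub>R e" by (simp add: algebra_simps)
  with u have "\<exists>u. p + v *\<^sub>R e + u *\<^sub>R e \<in> ball x0 \<rho>" by metis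
  with assms show ?thesis by (auto simp: slab_def height_shift)
qed

text \<open>The \<open>N\<close> vertical translates of a slab of thickness \<open>S / N\<close> are disjoint.\<close>
lemma slab_emeasure_le:
  assumes a: "0 < a" and S: "0 < S" and N: "0 < N"
  shows "of_nat N * emeasure lborel (slab \<rho> a (S / real N))
    \<le> emeasure lborel (cball x0 (\<rho> + S + \<Lambda> * \<rho>))"
proof -
  define P where "P = slab \<rho> a (S / real N)"
  define T where "T i = (\<lambda>p. (real i * S / real N) *\<^sub>R e + p) ` P" for i :: nat
  have [measurable]: "P \<in> sets borel" by (simp add: P_def)
  have T_eq: "T i = (\<lambda>p. - ((real i * S / real N) *\<^sub>R e) + p) -` P" for i
    unfolding T_def by (force simp: image_iff)
  have Tm [measurable]: "T i \<in> sets borel" for i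
    unfolding T_eq
    using measurable_sets[of "\<lambda>p. - ((real i * S / real N) *\<^sub>R e) + p" borel borel P]
    by (simp del: add_uminus_conv_diff uminus_add_conv_diff)
  have em: "emeasure lborel (T i) = emeasure lborel P" for i
    using emeasure_distr[of "\<lambda>p. - ((real i * S / real N) *\<^sub>R e) + p" lborel borel P]
    by (simp add: T_eq lborel_distr_plus del: add_uminus_conv_diff uminus_add_conv_diff)
  \<comment> \<open>Positivity of \<open>a\<close> makes the lower inequality strict. The heights in
    the translates thus lie in consecutive half-open intervals, which are disjoint.\<close>
  have ht: "real i * S / N < t q \<and> t q \<le> real (Suc i) * S / N \<and> q \<in> slab \<rho> (t q) (t q)" if q: "q \<in> T i" for i q
  proof -
    obtain p where "p \<in> P" "q = (real i * S / real N) *\<^sub>R e + p"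
      using q unfolding T_def by blast
    then have p: "p \<in> P" "q = p + (real i * S / real N) *\<^sub>R e" by (simp_all add: add.commute)
    have "p \<in> slab \<rho> (t p) (t p)" "a \<le> t p" "t p \<le> S / N" using p(1) by (auto simp: P_def slab_def)
    then have "t q = t p + real i * S / N" "q \<in> slab \<rho> (t q) (t q)"
      using slab_shift[of p \<rho> "t p" "t p" "real i * S / real N"] by (simp_all add: p(2) height_shift)
    moreover have "real (Suc i) * S / N = real i * S / N + S / N" by (simp add: add_divide_distrib ring_distribs)
    ultimately show ?thesis using a \<open>a \<le> t p\<close> \<open>t p \<le> S / N\<close> by simp
  qed
  have disj: "disjoint_family_on T {..<N}"
  proof (clarsimp simp: disjoint_family_on_def)
    have *: False if "i < j" "q \<in> T i" "q \<in> T j" for i j q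
    proof -
      have "real (Suc i) * S / N \<le> real j * S / N"
        using that(1) S by (intro divide_right_mono mult_right_mono) auto
      with ht[OF that(2)] ht[OF that(3)] show False by linarith
    qed
    show "T i \<inter> T j = {}" if "i \<noteq> j" for i j
      using that * by (metis disjoint_iff nat_neq_iff)
  qed
  have "of_nat N * emeasure lborel P = (\<Sum>i<N. emeasure lborel (T i))" by (simp add: em)
  also have "\<dots> = emeasure lborel (\<Union>i<N. T i)"
    using disj by (intro sum_emeasure) auto
  also have "\<dots> \<le> emeasure lborel (cball x0 (\<rho> + S + \<Lambda> * \<rho>))"
  proof (rule emeasure_mono)
    show "(\<Union>i<N. T i) \<subseteq> cball x0 (\<rho> + S + \<Lambda> * \<rho>)"
    proof clarify
      fix i q assume i: "i < N" and q: "q \<in> T i"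
      have "real (Suc i) * S \<le> real N * S" using i S by (intro mult_right_mono) auto
      then have "real (Suc i) * S / N \<le> S" using N by (simp add: divide_le_eq mult.commute)
      moreover have "0 \<le> real i * S / N" using S by auto
      ultimately have "\<bar>t q\<bar> \<le> S" using ht[OF q] by linarith
      with slab_dist_base[of q \<rho> "t q" "t q" S] ht[OF q] show "q \<in> cball x0 (\<rho> + S + \<Lambda> * \<rho>)"
        by (simp add: dist_commute)
    qed
  qed auto
  finally show ?thesis by (simp add: P_def)
qed


section \<open>Integrability near a boundary point\<close>

text \<open>Each ball only has to admit some approximating constant, so the mean of any function
  that agrees with \<open>f\<close> almost everywhere on the ball may serve. The chosen constants
  \<open>c p\<close> take the place of the means in the chain argument.\<close>

lemma nn_integral_finite_near_base:
  fixes \<Omega> :: "'a set" and f :: "'a \<Rightarrow> real"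
  assumes [measurable]: "f \<in> borel_measurable borel"
    and R: "0 < R" and \<Omega>: "\<And>p. p \<in> ball x0 R \<Longrightarrow> p \<in> \<Omega> \<longleftrightarrow> 0 < t p"
    and M: "0 \<le> M"
    and osc: "\<And>p r. 0 < r \<Longrightarrow> r < R \<Longrightarrow> cball p r \<subseteq> \<Omega> \<Longrightarrow>
      \<exists>c. (\<integral>\<^sup>+q\<in>cball p r. ennreal \<bar>f q - c\<bar> \<partial>lborel) \<le> ennreal M * emeasure lborel (cball p r)"
    and loc: "\<And>K. compact K \<Longrightarrow> K \<subseteq> \<Omega> \<Longrightarrow> (\<integral>\<^sup>+q\<in>K. ennreal \<bar>f q\<bar> \<partial>lborel) < \<infinity>"
  shows "\<exists>\<rho>>0. (\<integral>\<^sup>+q\<in>\<Omega> \<inter> ball x0 \<rho>. ennreal \<bar>f q\<bar> \<partial>lborel) < \<infinity>"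
proof -
  note L = Lambda_ge_1
  \<comment> \<open>With this radius the heights in \<open>ball x0 \<rho>\<close> are at most
    \<open>\<sigma>\<close>. Moreover \<open>8 * \<sigma> = R / 2\<close>, so
    \<open>cball x0 (8 * \<sigma>)\<close>, which contains every \<open>cball p (rad p)\<close> used
    below, lies inside \<open>ball x0 R\<close>.\<close>
  define \<rho> where "\<rho> = R / (16 * \<Lambda>)"
  define \<sigma> where "\<sigma> = \<Lambda> * \<rho>"
  have \<rho>: "0 < \<rho>" and \<sigma>: "0 < \<sigma>" "\<sigma> = R / 16" "\<rho> \<le> \<sigma>"
    using R L mult_right_mono[of 1 \<Lambda> \<rho>] by (auto simp: \<rho>_def \<sigma>_def field_simps)
  define v where "v r = emeasure lborel (cball (0::'a) r)" for r
  have v: "emeasure lborel (cball p r) = v r" if "0 \<le> r" for p :: 'a and r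
    using that by (simp add: v_def emeasure_cball)
  have v_scale: "v (k * r) = ennreal (k ^ DIM('a)) * v r" if "0 \<le> r" "0 \<le> k" for k r
    using that by (simp add: v_def emeasure_cball power_mult_distrib ennreal_mult' mult_ac)
  have v_mono: "v r \<le> v s" if "r \<le> s" for r s
    using that unfolding v_def by (intro emeasure_mono) auto
  have v_pos: "0 < v r" "v r < \<infinity>" if "0 < r" for r
    using that by (simp_all add: v_def emeasure_cball)

  define G where "G = {p \<in> slab (2 * \<rho>) 0 (2 * \<sigma>). 0 < t p}"
  \<comment> \<open>On \<open>cball p (rad p)\<close> the height differs from \<open>t p\<close> by
    at most \<open>t p / 2\<close>, so the ball stays above the graph.\<close>
  define rad where "rad p = t p / (2 * \<Lambda>)" for p
  have rad: "0 < rad p" "rad p \<le> \<rho>" "rad p < R" "\<Lambda> * rad p = t p / 2" if "p \<in> G" for p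
  proof -
    have "t p \<le> 2 * \<sigma>" "0 < t p" using that by (auto simp: G_def slab_def)
    then show "0 < rad p" "rad p \<le> \<rho>" "\<Lambda> * rad p = t p / 2"
      using L by (auto simp: rad_def \<sigma>_def field_simps)
    moreover have "\<rho> < R" using \<sigma> R by linarith
    ultimately show "rad p < R" by linarith
  qed
  have ball: "t p / 2 \<le> t q \<and> q \<in> cball x0 (8 * \<sigma>)" if p: "p \<in> G" and q: "q \<in> cball p (rad p)" for p q
  proof -
    have "p \<in> slab (2 * \<rho>) (t p) (t p)" using p by (auto simp: G_def slab_def)
    from cball_subset_slab[OF this, of "rad p"] q rad(4)[OF p]
    have q: "q \<in> slab (2 * \<rho> + rad p) (t p / 2) (3 * t p / 2)" by auto
    have tp: "0 < t p" "t p \<le> 2 * \<sigma>" using p by (auto simp: G_def slab_def)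
    have "dist p x0 \<le> 2 * \<rho> + 2 * \<sigma> + \<Lambda> * (2 * \<rho>)"
      using p tp by (intro slab_dist_base[of _ _ 0 "2 * \<sigma>"]) (auto simp: G_def)
    moreover have "dist p q \<le> \<rho>" using that rad(2)[OF p] by simp
    moreover have "dist x0 q \<le> dist p x0 + dist p q" by (metis dist_commute dist_triangle)
    ultimately have "dist x0 q \<le> 2 * \<rho> + 2 * \<sigma> + 2 * \<sigma> + \<rho>" by (simp add: \<sigma>_def)
    with \<sigma> \<rho> q show ?thesis by (auto simp: slab_def)
  qed
  have in_\<Omega>: "q \<in> \<Omega>" if "q \<in> cball x0 (8 * \<sigma>)" "0 < t q" for q
    using that \<sigma> R \<Omega>[of q] by auto
  have "cball p (rad p) \<subseteq> \<Omega>" if p: "p \<in> G" for p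
    using ball[OF p] in_\<Omega> rad(1)[OF p] that by (force simp: G_def)
  then have "\<forall>p\<in>G. \<exists>c. (\<integral>\<^sup>+q\<in>cball p (rad p). ennreal \<bar>f q - c\<bar> \<partial>lborel) \<le> ennreal M * v (rad p)"
    using osc rad v by (metis less_imp_le)
  then obtain c where c: "(\<integral>\<^sup>+q\<in>cball p (rad p). ennreal \<bar>f q - c p\<bar> \<partial>lborel) \<le> ennreal M * v (rad p)"
    if "p \<in> G" for p by metis

  \<comment> \<open>Balls centred at height at least \<open>\<sigma>\<close> lie in a fixed compact subset of \<open>\<Omega>\<close>, where the chains below end.\<close>
  define K where "K = {q \<in> cball x0 (8 * \<sigma>). \<sigma> / 2 \<le> t q}"
  define I where "I = (\<integral>\<^sup>+q\<in>K. ennreal \<bar>f q\<bar> \<partial>lborel)"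
  have "closed K"
    using closed_Int[OF closed_cball[of x0 "8 * \<sigma>"]
        closed_Collect_le[OF continuous_on_const[of _ "\<sigma> / 2"] height_continuous]]
    by (simp add: K_def Collect_conj_eq cball_def)
  then have "compact K" by (auto simp: K_def compact_eq_bounded_closed intro: bounded_subset[OF bounded_cball])
  moreover have "K \<subseteq> \<Omega>" using in_\<Omega> \<sigma> by (auto simp: K_def)
  ultimately have I: "I < \<infinity>" unfolding I_def by (rule loc)
  define v0 where "v0 = v (\<sigma> / (2 * \<Lambda>))"
  have v0: "0 < v0" "v0 < \<infinity>" using \<sigma> L v_pos[of "\<sigma> / (2 * \<Lambda>)"] by (auto simp: v0_def)
  \<comment> \<open>\<open>M\<close> accounts for the oscillation, and \<open>I / v0\<close> for the
    average of the absolute value of \<open>f\<close> over a ball in \<open>K\<close>, whose volume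
    is at least \<open>v0\<close>.\<close>
  define K0 where "K0 = M + enn2real (I / v0)"
  have K0: "0 \<le> K0" using M by (simp add: K0_def)

  have base: "\<bar>c p\<bar> \<le> K0" if p: "p \<in> G" "\<sigma> \<le> t p" for p
  proof -
    have vr: "v0 \<le> v (rad p)"
      using p L by (auto simp: v0_def rad_def intro!: v_mono divide_right_mono)
    have vp: "0 < v (rad p)" "v (rad p) < \<infinity>" using v_pos rad(1)[OF p(1)] by auto
    have "ennreal \<bar>c p\<bar> * v (rad p)
      \<le> (\<integral>\<^sup>+q\<in>cball p (rad p). ennreal \<bar>f q - c p\<bar> \<partial>lborel) + (\<integral>\<^sup>+q\<in>cball p (rad p). ennreal \<bar>f q\<bar> \<partial>lborel)"
      using const_diff_le_oscillation[of f lborel "cball p (rad p)" "c p" 0] v rad(1)[OF p(1)] by simp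
    also have "\<dots> \<le> ennreal M * v (rad p) + I"
      unfolding I_def using ball[OF p(1)] p(2)
      by (intro add_mono c p nn_set_integral_mono_set) (force simp: K_def)
    also have "\<dots> \<le> ennreal M * v (rad p) + ennreal (enn2real (I / v0)) * v (rad p)"
    proof (rule add_left_mono)
      have "I = I / v0 * v0"
        using v0 by (simp add: ennreal_divide_times ennreal_times_divide mult_divide_eq_ennreal)
      also have "\<dots> \<le> I / v0 * v (rad p)" by (rule mult_left_mono[OF vr]) simp
      also have "I / v0 = ennreal (enn2real (I / v0))"
        using I v0 by (intro ennreal_enn2real[symmetric]) (auto simp: less_top[symmetric] ennreal_divide_eq_top_iff)
      finally show "I \<le> ennreal (enn2real (I / v0)) * v (rad p)" .
    qed
    also have "\<dots> = ennreal K0 * v (rad p)"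
      using M by (simp add: K0_def distrib_right)
    finally have "ennreal \<bar>c p\<bar> \<le> ennreal K0"
      using vp by (rule ennreal_mult_right_le_cancel)
    with K0 show ?thesis by (simp add: ennreal_le_iff)
  qed

  \<comment> \<open>One step raises \<open>p\<close> by \<open>t p / (4 * \<Lambda>)\<close>, half
    of its radius, and so multiplies height and radius by \<open>\<kappa>\<close>. The ball about
    \<open>p\<close> with half the radius then lies in both the old and the new ball.\<close>
  define \<kappa> where "\<kappa> = 1 + 1 / (4 * \<Lambda>)"
  have \<kappa>: "1 < \<kappa>" "\<kappa> \<le> 2" using L by (auto simp: \<kappa>_def field_simps)
  \<comment> \<open>The two balls have radii \<open>2 * h\<close> and
    \<open>2 * \<kappa> * h \<le> 4 * h\<close>, while their constants are compared on a ball of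
    radius \<open>h\<close>; the powers of 2 and 4 are the volume ratios.\<close>
  define C where "C = M * (2 ^ DIM('a) + 4 ^ DIM('a))"
  have C: "0 \<le> C" using M by (simp add: C_def)
  have step: "\<exists>p'\<in>G. t p' = \<kappa> * t p \<and> \<bar>c p - c p'\<bar> \<le> C" if p: "p \<in> G" "t p \<le> \<sigma>" for p
  proof -
    define p' where "p' = p + (t p / (4 * \<Lambda>)) *\<^sub>R e"
    have tp: "0 < t p" using p by (simp add: G_def)
    have t': "t p' = \<kappa> * t p" by (simp add: p'_def height_shift \<kappa>_def ring_distribs)
    have t'': "\<kappa> * t p \<le> 2 * \<sigma>" using \<kappa> p tp by (intro mult_mono) auto
    have "p' \<in> slab (2 * \<rho>) (t p + t p / (4 * \<Lambda>)) (t p + t p / (4 * \<Lambda>))"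
      unfolding p'_def using p by (intro slab_shift) (auto simp: G_def slab_def)
    then have p': "p' \<in> G" using t' t'' tp \<kappa> by (auto simp: G_def slab_def)
    define h where "h = rad p / 2"
    have r: "rad p = 2 * h" "rad p' = (2 * \<kappa>) * h" "0 < h"
      using tp L by (auto simp: rad_def t' h_def)
    have d: "dist p p' = h" using tp L by (simp add: p'_def dist_norm norm_e h_def rad_def)
    have "2 * h \<le> 2 * \<kappa> * h" using \<kappa> r(3) by simp
    then have sub: "cball p h \<subseteq> cball p (rad p)" "cball p h \<subseteq> cball p' (rad p')"
      using r d by (simp_all add: cball_subset_cball_iff)
    have "ennreal \<bar>c p - c p'\<bar> * v h
      \<le> (\<integral>\<^sup>+q\<in>cball p h. ennreal \<bar>f q - c p\<bar> \<partial>lborel) + (\<integral>\<^sup>+q\<in>cball p h. ennreal \<bar>f q - c p'\<bar> \<partial>lborel)"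
      using const_diff_le_oscillation[of f lborel "cball p h" "c p" "c p'"] v[of h] r(3) by simp
    also have "\<dots> \<le> (\<integral>\<^sup>+q\<in>cball p (rad p). ennreal \<bar>f q - c p\<bar> \<partial>lborel) + (\<integral>\<^sup>+q\<in>cball p' (rad p'). ennreal \<bar>f q - c p'\<bar> \<partial>lborel)"
      by (intro add_mono nn_set_integral_mono_set sub)
    also have "\<dots> \<le> ennreal M * v (rad p) + ennreal M * v (rad p')"
      by (intro add_mono c p p')
    also have "\<dots> \<le> ennreal M * v (2 * h) + ennreal M * v (4 * h)"
      using r \<kappa> by (intro add_mono mult_left_mono v_mono) auto
    also have "\<dots> = ennreal C * v h"
      using M r(3) by (simp add: v_scale C_def ennreal_mult distrib_right distrib_left mult.assoc)
    finally have "ennreal \<bar>c p - c p'\<bar> \<le> ennreal C"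
      using v_pos[OF r(3)] by (rule ennreal_mult_right_le_cancel)
    with C have "\<bar>c p - c p'\<bar> \<le> C" by (simp add: ennreal_le_iff)
    with p' t' show ?thesis by blast
  qed

  \<comment> \<open>Climb until height \<open>\<sigma>\<close> is reached, where \<open>base\<close>
    applies; each step costs at most \<open>C\<close>, and a point that is already high enough stops
    early. The number of steps needed is logarithmic in \<open>\<sigma> / t p\<close>.\<close>
  have chain: "\<bar>c p\<bar> \<le> K0 + real k * C" if "p \<in> G" "\<sigma> \<le> \<kappa> ^ k * t p" for p k
    using that
  proof (induction k arbitrary: p)
    case 0
    then show ?case using base by simp
  next
    case (Suc k)
    show ?case
    proof (cases "\<sigma> \<le> t p")
      case True
      with base[of p] Suc.prems C K0 show ?thesis by (auto intro: add_increasing2)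
    next
      case False
      then obtain p' where "p' \<in> G" "t p' = \<kappa> * t p" "\<bar>c p - c p'\<bar> \<le> C"
        using step[of p] Suc.prems by auto
      with Suc.IH[of p'] Suc.prems show ?thesis by (auto simp: algebra_simps)
    qed
  qed

  \<comment> \<open>\<open>J\<close> steps more than double the height, so
    \<open>J * (k + 2)\<close> steps suffice from any height at least
    \<open>\<sigma> / 2 ^ (k + 2)\<close>.\<close>
  obtain J where J: "2 < \<kappa> ^ J" using \<kappa>(1) real_arch_pow by blast
  \<comment> \<open>\<open>A k\<close> bounds the average of the absolute value of \<open>f\<close>
    over a ball of radius \<open>d k\<close> centred in \<open>P k\<close>. The power of 9 pays for
    enlarging that ball to radius \<open>rad p\<close>: heights in \<open>P k\<close> are at most 8
    times the lowest one, so \<open>rad p \<le> 9 * d k\<close>.\<close>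
  define A where "A k = 9 ^ DIM('a) * (M + (K0 + real (J * (k + 2)) * C))" for k
  have A0: "0 \<le> A k" for k using M K0 C by (simp add: A_def)
  \<comment> \<open>\<open>Q k\<close> is a dyadic layer, \<open>P k\<close> a thicker slab that
    holds all balls of radius \<open>d k\<close> about points of \<open>Q k\<close>, and
    \<open>d k\<close> is the value of \<open>rad\<close> at the lowest height in
    \<open>P k\<close>. Neighbouring layers share a level, which is harmless for an upper
    bound.\<close>
  define Q where "Q k = {p \<in> ball x0 \<rho>. \<sigma> / 2 ^ Suc k \<le> t p \<and> t p \<le> \<sigma> / 2 ^ k}" for k :: nat
  define P where "P k = slab (2 * \<rho>) (\<sigma> / 2 ^ (k + 2)) (2 * \<sigma> / 2 ^ k)" for k
  define d where "d k = \<sigma> / 2 ^ (k + 2) / (2 * \<Lambda>)" for k :: nat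
  define V where "V = emeasure lborel (cball x0 (2 * \<rho> + 2 * \<sigma> + \<Lambda> * (2 * \<rho>)))"
  have "V < \<infinity>" unfolding V_def by (rule emeasure_bounded_finite[OF bounded_cball])
  have Q_meas [measurable]: "Q k \<in> sets borel" for k
  proof -
    have "Q k = ball x0 \<rho> \<inter> {p \<in> space borel. \<sigma> / 2 ^ Suc k \<le> t p \<and> t p \<le> \<sigma> / 2 ^ k}"
      by (auto simp: Q_def)
    also have "\<dots> \<in> sets borel" by measurable
    finally show ?thesis .
  qed
  have layer: "(\<integral>\<^sup>+q\<in>Q k. ennreal \<bar>f q\<bar> \<partial>lborel) \<le> ennreal (A k) * emeasure lborel (P k)" for k
  proof (rule nn_integral_le_of_cball_bound[where r = "d k"])
    show d0: "0 < d k" using \<sigma> L by (simp add: d_def)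
    have Ld: "\<Lambda> * d k = \<sigma> / 2 ^ (k + 2) / 2" using L by (simp add: d_def)
    have d\<rho>: "d k \<le> \<rho>"
    proof -
      have "d k = \<rho> / 2 ^ (k + 3)" using L by (simp add: d_def \<sigma>_def power_add)
      also have "\<dots> \<le> \<rho>" using \<rho> by (simp add: divide_le_eq)
      finally show ?thesis .
    qed
    show "cball q (d k) \<subseteq> P k" if "q \<in> Q k" for q
    proof -
      have "q \<in> slab \<rho> (\<sigma> / 2 ^ Suc k) (\<sigma> / 2 ^ k)"
        using that by (auto simp: Q_def slab_def intro!: exI[of _ 0])
      then have "cball q (d k) \<subseteq> slab (\<rho> + d k) (\<sigma> / 2 ^ Suc k - \<Lambda> * d k) (\<sigma> / 2 ^ k + \<Lambda> * d k)"
        by (rule cball_subset_slab)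
      also have "\<dots> \<subseteq> P k"
      proof -
        have "\<sigma> / 2 ^ (k + 2) \<le> \<sigma> / 2 ^ Suc k - \<Lambda> * d k" "\<sigma> / 2 ^ k + \<Lambda> * d k \<le> 2 * \<sigma> / 2 ^ k"
          using \<sigma> by (auto simp: Ld field_simps)
        with d\<rho> show ?thesis unfolding P_def by (intro slab_mono) auto
      qed
      finally show ?thesis .
    qed
    show "(\<integral>\<^sup>+q\<in>cball p (d k). ennreal \<bar>f q\<bar> \<partial>lborel) \<le> ennreal (A k) * emeasure lborel (cball p (d k))"
      if "p \<in> P k" for p
    proof -
      have tp: "\<sigma> / 2 ^ (k + 2) \<le> t p" "t p \<le> 2 * \<sigma> / 2 ^ k" using that by (auto simp: P_def slab_def)
      have "0 < \<sigma> / 2 ^ (k + 2)" "2 * \<sigma> / 2 ^ k \<le> 2 * \<sigma>" using \<sigma> by (auto simp: field_simps)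
      with tp that have G: "p \<in> G" by (auto simp: P_def G_def slab_def)
      have "\<sigma> = 2 ^ (k + 2) * (\<sigma> / 2 ^ (k + 2))" by simp
      also have "\<dots> \<le> (\<kappa> ^ J) ^ (k + 2) * t p"
        using J tp \<sigma> by (intro mult_mono power_mono) auto
      finally have cp: "\<bar>c p\<bar> \<le> K0 + real (J * (k + 2)) * C"
        by (intro chain[OF G]) (simp only: power_mult)
      have le: "d k \<le> rad p" using tp(1) L unfolding d_def rad_def by (intro divide_right_mono) auto
      have ge: "rad p \<le> 9 * d k"
      proof -
        have "t p \<le> 9 * (\<sigma> / 2 ^ (k + 2))" using tp \<sigma> by (auto simp: field_simps)
        then have "t p / (2 * \<Lambda>) \<le> 9 * (\<sigma> / 2 ^ (k + 2)) / (2 * \<Lambda>)" using L by (intro divide_right_mono) auto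
        then show ?thesis by (simp add: rad_def d_def)
      qed
      have "(\<integral>\<^sup>+q\<in>cball p (d k). ennreal \<bar>f q\<bar> \<partial>lborel) \<le> (\<integral>\<^sup>+q\<in>cball p (rad p). ennreal \<bar>f q\<bar> \<partial>lborel)"
        using le by (intro nn_set_integral_mono_set) auto
      also have "\<dots> \<le> (\<integral>\<^sup>+q\<in>cball p (rad p). ennreal \<bar>f q - c p\<bar> \<partial>lborel) + ennreal \<bar>c p\<bar> * v (rad p)"
        using nn_integral_abs_le_oscillation[of f lborel "cball p (rad p)" "c p"] v rad(1)[OF G] by simp
      also have "\<dots> \<le> ennreal M * v (rad p) + ennreal (K0 + real (J * (k + 2)) * C) * v (rad p)"
        using cp by (intro add_mono c G mult_right_mono ennreal_leI) auto
      also have "\<dots> = ennreal (M + (K0 + real (J * (k + 2)) * C)) * v (rad p)"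
        using M K0 C by (simp add: distrib_right)
      also have "\<dots> \<le> ennreal (M + (K0 + real (J * (k + 2)) * C)) * v (9 * d k)"
        by (intro mult_left_mono v_mono ge) auto
      also have "\<dots> = ennreal (A k) * emeasure lborel (cball p (d k))"
        using d0 M K0 C v_scale[of "d k" 9] v[of "d k" p]
        by (simp add: A_def ennreal_mult mult_ac del: ennreal_plus)
      finally show ?thesis .
    qed
  qed (auto simp: P_def)
  have layer': "(\<integral>\<^sup>+q\<in>Q k. ennreal \<bar>f q\<bar> \<partial>lborel) \<le> ennreal (A k * (1 / 2) ^ k) * V" for k
  proof -
    \<comment> \<open>The translates fill heights up to \<open>S = 2 * \<sigma>\<close>; with
      \<open>N = 2 ^ k\<close> the thickness \<open>S / N\<close> is the upper height of
      \<open>P k\<close>, and \<open>V\<close> does not depend on \<open>k\<close>.\<close>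
    have "2 ^ k * emeasure lborel (P k) \<le> V"
      using slab_emeasure_le[of "\<sigma> / 2 ^ (k + 2)" "2 * \<sigma>" "2 ^ k" "2 * \<rho>"] \<sigma>(1)
      by (simp add: P_def V_def)
    then have "ennreal ((1 / 2) ^ k) * (2 ^ k * emeasure lborel (P k)) \<le> ennreal ((1 / 2) ^ k) * V"
      by (rule mult_left_mono) simp
    moreover have "ennreal ((1 / 2) ^ k) * 2 ^ k = 1"
    proof -
      have "(2::ennreal) ^ k = ennreal (2 ^ k)" by (metis ennreal_numeral ennreal_power zero_le_numeral)
      then show ?thesis by (simp add: ennreal_mult[symmetric] power_mult_distrib[symmetric])
    qed
    ultimately have "emeasure lborel (P k) \<le> ennreal ((1 / 2) ^ k) * V"
      by (simp add: mult.assoc[symmetric])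
    then have "ennreal (A k) * emeasure lborel (P k) \<le> ennreal (A k) * (ennreal ((1 / 2) ^ k) * V)"
      by (rule mult_left_mono) simp
    with layer[of k] A0[of k] show ?thesis by (simp add: ennreal_mult mult.assoc)
  qed
  have cover: "\<Omega> \<inter> ball x0 \<rho> \<subseteq> (\<Union>k. Q k)"
  proof
    fix q assume q: "q \<in> \<Omega> \<inter> ball x0 \<rho>"
    have "\<rho> < R" using \<sigma> R by linarith
    then have tq: "0 < t q" using q \<Omega>[of q] by auto
    have "\<bar>t q\<bar> \<le> \<Lambda> * dist q x0" using height_lipschitz[of q x0] height_base by simp
    also have "\<dots> \<le> \<sigma>" using q L by (auto simp: \<sigma>_def dist_commute intro!: mult_left_mono)
    finally have tq': "t q \<le> \<sigma>" by simp
    obtain m where m: "\<sigma> / t q < 2 ^ m" using real_arch_pow[of 2] by auto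
    \<comment> \<open>Since \<open>t q \<le> \<sigma>\<close>, the least exponent is not 0. Its
      predecessor \<open>j\<close> satisfies \<open>2 ^ j \<le> \<sigma> / t q < 2 ^ Suc j\<close>,
      which puts \<open>q\<close> into \<open>Q j\<close>.\<close>
    define k where "k = (LEAST m. \<sigma> / t q < 2 ^ m)"
    have k: "\<sigma> / t q < 2 ^ k" unfolding k_def using m by (rule LeastI)
    have "k \<noteq> 0" using k tq tq' by (auto simp: field_simps intro!: gr0I)
    then obtain j where j: "k = Suc j" by (cases k) auto
    have "\<not> \<sigma> / t q < 2 ^ j" using not_less_Least[of j "\<lambda>m. \<sigma> / t q < 2 ^ m"] j k_def by auto
    then have "q \<in> Q j" using k tq q j by (auto simp: Q_def field_simps)
    then show "q \<in> (\<Union>k. Q k)" by blast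
  qed
  have sumA: "summable (\<lambda>k. A k * (1 / 2) ^ k)"
  proof -
    have s1: "summable (\<lambda>k. (1 / 2 :: real) ^ k)" by (rule summable_geometric) simp
    have s2: "summable (\<lambda>k. real (Suc k) * (1 / 2) ^ k)"
      using geometric_deriv_sums[of "1 / 2 :: real"] by (auto simp: sums_iff)
    \<comment> \<open>Writing \<open>k + 2\<close> as \<open>1 + Suc k\<close> splits the terms into
      those of a geometric series and those of its derivative.\<close>
    have "A k * (1 / 2) ^ k = 9 ^ DIM('a) * (M + K0 + real J * C) * (1 / 2) ^ k
        + 9 ^ DIM('a) * real J * C * (real (Suc k) * (1 / 2) ^ k)" for k
      by (simp add: A_def algebra_simps)
    with s1 s2 show ?thesis by (simp only: summable_add summable_mult)
  qed
  have "(\<integral>\<^sup>+q\<in>\<Omega> \<inter> ball x0 \<rho>. ennreal \<bar>f q\<bar> \<partial>lborel) \<le> (\<integral>\<^sup>+q\<in>(\<Union>k. Q k). ennreal \<bar>f q\<bar> \<partial>lborel)"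
    by (rule nn_set_integral_mono_set[OF cover])
  also have "\<dots> \<le> (\<integral>\<^sup>+q. (\<Sum>k. ennreal \<bar>f q\<bar> * indicator (Q k) q) \<partial>lborel)"
  proof (rule nn_integral_mono)
    fix q
    show "ennreal \<bar>f q\<bar> * indicator (\<Union>k. Q k) q \<le> (\<Sum>k. ennreal \<bar>f q\<bar> * indicator (Q k) q)"
    proof (cases "q \<in> (\<Union>k. Q k)")
      case True
      then obtain k where "q \<in> Q k" by blast
      with True sum_le_suminf[of "\<lambda>k. ennreal \<bar>f q\<bar> * indicator (Q k) q" "{k}"] show ?thesis by simp
    qed simp
  qed
  also have "\<dots> = (\<Sum>k. \<integral>\<^sup>+q\<in>Q k. ennreal \<bar>f q\<bar> \<partial>lborel)"
    by (rule nn_integral_suminf) measurable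
  also have "\<dots> \<le> (\<Sum>k. ennreal (A k * (1 / 2) ^ k) * V)"
    by (intro suminf_le layer') auto
  also have "\<dots> = (\<Sum>k. ennreal (A k * (1 / 2) ^ k)) * V"
    by (rule ennreal_suminf_multc)
  also have "\<dots> < \<infinity>"
    using sumA A0 \<open>V < \<infinity>\<close> by (simp add: suminf_ennreal2 ennreal_mult_less_top)
  finally show ?thesis using \<rho> by blast
qed

end

section \<open>Graph coordinates at a boundary point\<close>

text \<open>The gradient is differentiable, hence continuous and bounded on the compact ball;
  convexity of the ball gives the mean value inequality. The strict inequality \<open>r < a\<close>
  avoids the edge, where the gradient may be unbounded.\<close>

lemma C2_on_lipschitz:
  assumes h: "C2_on (ball 0 a) h" and r: "r < a"
  obtains L where "0 \<le> L" "\<And>x y. x \<in> cball 0 r \<Longrightarrow> y \<in> cball 0 r \<Longrightarrow> \<bar>h x - h y\<bar> \<le> L * dist x y"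
proof -
  obtain g H where g: "\<And>x. x \<in> ball 0 a \<Longrightarrow> GDERIV h x :> g x"
    and H: "\<And>x. x \<in> ball 0 a \<Longrightarrow> (g has_derivative (\<lambda>u. H x *v u)) (at x)"
    using h unfolding C2_on_def by blast
  have sub: "cball 0 r \<subseteq> ball 0 a" using r by auto
  have "continuous_on (cball 0 r) g"
    using H sub by (intro continuous_at_imp_continuous_on) (blast intro: has_derivative_continuous)
  then have "bounded (g ` cball 0 r)"
    by (intro compact_imp_bounded compact_continuous_image) auto
  then obtain L where L: "0 < L" "\<And>x. x \<in> cball 0 r \<Longrightarrow> norm (g x) \<le> L"
    by (auto simp: bounded_pos)
  have "norm (h x - h y) \<le> L * norm (x - y)" if xy: "x \<in> cball 0 r" "y \<in> cball 0 r" for x y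
  proof (rule differentiable_bound[OF convex_cball[of 0 r] _ _ xy])
    fix z :: "real ^ 'a" assume z: "z \<in> cball 0 r"
    then have "GDERIV h z :> g z" using g sub by blast
    then show "(h has_derivative (\<lambda>u. u \<bullet> g z)) (at z within cball 0 r)"
      unfolding gderiv_def by (rule has_derivative_at_withinI)
    show "onorm (\<lambda>u. u \<bullet> g z) \<le> L"
    proof (rule onorm_le)
      fix u
      have "norm (u \<bullet> g z) \<le> norm u * norm (g z)" by (simp add: Cauchy_Schwarz_ineq2)
      also have "\<dots> \<le> norm u * L" using L(2)[OF z] by (intro mult_left_mono) auto
      finally show "norm (u \<bullet> g z) \<le> L * norm u" by (simp add: mult.commute)
    qed
  qed
  with L(1) show ?thesis by (intro that[of L]) (auto simp: dist_norm)
qed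

text \<open>Pythagoras; applied to differences, it shows that the projection along \<open>e\<close>
  does not increase distances.\<close>

lemma norm_orthogonal_part_le:
  fixes w e :: "'a::real_inner"
  assumes "norm e = 1"
  shows "norm (w - (w \<bullet> e) *\<^sub>R e) \<le> norm w"
proof -
  have "e \<bullet> e = 1" using assms by (simp add: norm_eq_1)
  then have "(w - (w \<bullet> e) *\<^sub>R e) \<bullet> (w - (w \<bullet> e) *\<^sub>R e) = w \<bullet> w - (w \<bullet> e)\<^sup>2"
    by (simp add: inner_diff_left inner_diff_right inner_commute power2_eq_square)
  then show ?thesis by (simp add: norm_le)
qed

text \<open>The defining function of the boundary is only given on a disc; composing it with the nearest-point
  projection onto a smaller disc makes the height globally Lipschitz.\<close>
lemma C2_boundary_height:
  fixes \<Omega> :: "(real ^ 'n) set"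
  assumes "C2_boundary \<Omega>" "x0 \<in> frontier \<Omega>"
  obtains e t \<Lambda> R where "lipschitz_height e x0 t \<Lambda>" "0 < R"
    "\<And>p. p \<in> ball x0 R \<Longrightarrow> p \<in> \<Omega> \<longleftrightarrow> 0 < t p"
proof -
  obtain e h a b where e: "norm e = 1" and ab: "0 < a" "0 < b" and h: "C2_on (ball 0 a) h" "h 0 = 0"
    and \<Omega>: "\<And>y t. y \<bullet> e = 0 \<Longrightarrow> norm y < a \<Longrightarrow> \<bar>t\<bar> < b \<Longrightarrow>
      x0 + y + (h y + t) *\<^sub>R e \<in> \<Omega> \<longleftrightarrow> 0 < t"
    using bspec[OF assms(1)[unfolded C2_boundary_def] assms(2)] by blast
  define r where "r = a / 2"
  have r: "0 < r" "r < a" using ab by (auto simp: r_def)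
  obtain L where L: "0 \<le> L" "\<And>x y. x \<in> cball 0 r \<Longrightarrow> y \<in> cball 0 r \<Longrightarrow> \<bar>h x - h y\<bar> \<le> L * dist x y"
    using C2_on_lipschitz[OF h(1) r(2)] by blast
  define \<pi> where "\<pi> w = w - (w \<bullet> e) *\<^sub>R e" for w
  define s where "s = closest_point (cball (0 :: real ^ 'n) r)"
  \<comment> \<open>The projection \<open>\<pi>\<close> ignores vertical shifts, which gives the
    exact shift rule. Neither \<open>\<pi>\<close> nor \<open>s\<close> increases distances, so
    \<open>1 + L\<close> is a Lipschitz constant.\<close>
  define t where "t p = (p - x0) \<bullet> e - h (s (\<pi> (p - x0)))" for p
  have ee: "e \<bullet> e = 1" using e by (simp add: norm_eq_1)
  have s_in: "s w \<in> cball 0 r" for w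
    using r closest_point_in_set[of "cball 0 r" w] by (auto simp: s_def)
  have s_id: "s w = w" if "w \<in> cball 0 r" for w
    using that by (simp add: s_def closest_point_self)
  have s_lip: "dist (s v) (s w) \<le> dist v w" for v w
    using r unfolding s_def by (intro closest_point_lipschitz) auto
  have height: "lipschitz_height e x0 t (1 + L)"
  proof
    show "norm e = 1" by (rule e)
    show "t (p + u *\<^sub>R e) = t p + u" for p u
    proof -
      have "\<pi> (p + u *\<^sub>R e - x0) = \<pi> (p - x0)"
        by (simp add: \<pi>_def inner_diff_left inner_add_left ee algebra_simps)
      then show ?thesis by (simp add: t_def inner_diff_left inner_add_left ee)
    qed
    show "\<bar>t p - t q\<bar> \<le> (1 + L) * dist p q" for p q
    proof -
      have "\<pi> (p - x0) - \<pi> (q - x0) = \<pi> (p - q)"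
        by (simp add: \<pi>_def inner_diff_left algebra_simps)
      then have "dist (\<pi> (p - x0)) (\<pi> (q - x0)) \<le> dist p q"
        using norm_orthogonal_part_le[OF e, of "p - q"] by (simp only: dist_norm \<pi>_def)
      then have "dist (s (\<pi> (p - x0))) (s (\<pi> (q - x0))) \<le> dist p q"
        using s_lip order_trans by blast
      then have "\<bar>h (s (\<pi> (p - x0))) - h (s (\<pi> (q - x0)))\<bar> \<le> L * dist p q"
        using L(2)[OF s_in s_in] mult_left_mono[OF _ L(1)] order_trans by blast
      moreover have "\<bar>(p - q) \<bullet> e\<bar> \<le> dist p q"
        using Cauchy_Schwarz_ineq2[of "p - q" e] e by (simp add: dist_norm)
      moreover have "t p - t q = (p - q) \<bullet> e - (h (s (\<pi> (p - x0))) - h (s (\<pi> (q - x0))))"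
        by (simp add: t_def inner_diff_left)
      ultimately show ?thesis by (simp add: distrib_right)
    qed
    show "t x0 = 0" using r h(2) by (simp add: t_def \<pi>_def s_id)
  qed
  \<comment> \<open>The bound by \<open>r\<close> makes \<open>s\<close> the identity on the
    projected points, so that \<open>t\<close> is measured from the graph of \<open>h\<close>
    itself. The bound by \<open>b / (1 + L)\<close> keeps the height below \<open>b\<close>, where
    the local description of \<open>\<Omega>\<close> is valid.\<close>
  define R where "R = min r (b / (1 + L))"
  have R: "0 < R" "R \<le> r" "(1 + L) * R \<le> b"
  proof -
    show "0 < R" "R \<le> r" using r ab L(1) by (auto simp: R_def)
    have "(1 + L) * R \<le> (1 + L) * (b / (1 + L))" using L(1) by (intro mult_left_mono) (auto simp: R_def)
    then show "(1 + L) * R \<le> b" using L(1) by simp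
  qed
  have "p \<in> \<Omega> \<longleftrightarrow> 0 < t p" if p: "p \<in> ball x0 R" for p
  proof -
    define y where "y = \<pi> (p - x0)"
    have "norm y \<le> norm (p - x0)" unfolding y_def \<pi>_def by (rule norm_orthogonal_part_le[OF e])
    also have "\<dots> < R" using p by (simp add: dist_norm norm_minus_commute)
    finally have y: "norm y < R" .
    have "\<bar>t p\<bar> \<le> (1 + L) * dist p x0"
      using lipschitz_height.height_lipschitz[OF height, of p x0] lipschitz_height.height_base[OF height] by simp
    also have "\<dots> < (1 + L) * R" using p L(1) by (intro mult_strict_left_mono) (auto simp: dist_commute)
    finally have tb: "\<bar>t p\<bar> < b" using R(3) by simp
    have "s y = y" using y R(2) by (intro s_id) auto
    then have "h y + t p = (p - x0) \<bullet> e" by (simp add: t_def y_def)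
    then have "x0 + y + (h y + t p) *\<^sub>R e = p" by (simp add: y_def \<pi>_def)
    moreover have "y \<bullet> e = 0" by (simp add: y_def \<pi>_def inner_diff_left ee)
    ultimately show ?thesis using \<Omega>[of y "t p"] y R(2) r tb by auto
  qed
  with height R(1) show ?thesis by (rule that)
qed

section \<open>Borel representatives and integrability on bounded subsets\<close>

text \<open>Exhausting \<open>\<Omega>\<close> by compact sets exhibits \<open>f\<close>, cut off
  outside \<open>\<Omega>\<close>, as a limit of Lebesgue measurable functions. A Borel
  representative is wanted because the Tonelli argument runs on the product of Borel
  measures.\<close>

lemma L1_loc_borel_representative:
  fixes \<Omega> :: "(real ^ 'n) set"
  assumes \<Omega>: "open \<Omega>" and f: "f \<in> L1_loc \<Omega>"
  obtains g where "g \<in> borel_measurable borel" "AE x in lebesgue. x \<in> \<Omega> \<longrightarrow> f x = g x"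
proof -
  obtain C where C: "\<And>n. compact (C n)" "\<And>n. C n \<subseteq> \<Omega>" "\<And>n. C n \<subseteq> interior (C (Suc n))" "\<Union>(range C) = \<Omega>"
    by (rule open_Union_compact_subsets[OF \<Omega>]) (rule that)
  have "(\<lambda>x. indicat_real \<Omega> x * f x) \<in> borel_measurable lebesgue"
  proof (rule borel_measurable_LIMSEQ_real)
    show "(\<lambda>x. indicat_real (C n) x * f x) \<in> borel_measurable lebesgue" for n
      using f C(1,2)[of n] by (auto simp: L1_loc_def set_integrable_def)
    fix x
    show "(\<lambda>n. indicat_real (C n) x * f x) \<longlonglongrightarrow> indicat_real \<Omega> x * f x"
    proof (cases "x \<in> \<Omega>")
      case True
      then obtain m where m: "x \<in> C m" using C(4) by blast
      have "x \<in> C n" if "m \<le> n" for n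
        using lift_Suc_mono_le[of C, OF order_trans[OF C(3) interior_subset] that] m by blast
      then have "eventually (\<lambda>n. indicat_real (C n) x * f x = indicat_real \<Omega> x * f x) sequentially"
        using True by (auto simp: eventually_sequentially intro!: exI[of _ m])
      then show ?thesis by (rule tendsto_eventually)
    next
      case False
      then have "x \<notin> C n" for n using C(2) by blast
      with False show ?thesis by simp
    qed
  qed
  then obtain g where "g \<in> borel_measurable lborel" "AE x in lborel. indicat_real \<Omega> x * f x = g x"
    using completion_ex_borel_measurable_real by blast
  then show ?thesis
    by (intro that[of g]) (auto dest!: AE_completion elim!: eventually_mono)
qed

text \<open>Compactness of \<open>closure S\<close> reduces the claim to small balls about its
  points: about a point of \<open>\<Omega>\<close> local integrability suffices, about a boundary
  point the estimate in graph coordinates applies.\<close>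

lemma BMO_integrable_on_bounded:
  fixes \<Omega> S :: "(real ^ 'n) set"
  assumes \<Omega>: "open \<Omega>" "C2_boundary \<Omega>" and \<mu>: "0 < \<mu>" and f: "f \<in> L1_loc \<Omega>"
    and bmo: "BMO_seminorm \<mu> \<Omega> f < \<infinity>" and S: "S \<subseteq> \<Omega>" "bounded S"
  shows "(\<integral>\<^sup>+y\<in>S. ennreal \<bar>f y\<bar> \<partial>lebesgue) < \<infinity>"
proof -
  obtain g where g [measurable]: "g \<in> borel_measurable borel"
    and fg: "AE x in lebesgue. x \<in> \<Omega> \<longrightarrow> f x = g x"
    using L1_loc_borel_representative[OF \<Omega>(1) f] by blast
  have transfer: "(\<integral>\<^sup>+y\<in>A. ennreal \<bar>f y - c\<bar> \<partial>lebesgue) = (\<integral>\<^sup>+y\<in>A. ennreal \<bar>g y - c\<bar> \<partial>lborel)"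
    if [measurable]: "A \<in> sets borel" and A: "A \<subseteq> \<Omega>" for A c
  proof -
    have "(\<integral>\<^sup>+y\<in>A. ennreal \<bar>f y - c\<bar> \<partial>lebesgue) = (\<integral>\<^sup>+y\<in>A. ennreal \<bar>g y - c\<bar> \<partial>lebesgue)"
      using fg A by (intro nn_integral_cong_AE) (auto elim!: eventually_mono split: split_indicator)
    also have "\<dots> = (\<integral>\<^sup>+y\<in>A. ennreal \<bar>g y - c\<bar> \<partial>lborel)"
      by (rule nn_integral_completion) measurable
    finally show ?thesis .
  qed
  have loc: "(\<integral>\<^sup>+q\<in>K. ennreal \<bar>g q\<bar> \<partial>lborel) < \<infinity>" if K: "compact K" "K \<subseteq> \<Omega>" for K
  proof -
    have "integrable lebesgue (\<lambda>x. indicat_real K x *\<^sub>R f x)"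
      using f K by (auto simp: L1_loc_def set_integrable_def)
    then have "(\<integral>\<^sup>+x. ennreal (norm (indicat_real K x *\<^sub>R f x)) \<partial>lebesgue) < \<infinity>"
      by (simp add: integrable_iff_bounded)
    also have "(\<integral>\<^sup>+x. ennreal (norm (indicat_real K x *\<^sub>R f x)) \<partial>lebesgue) = (\<integral>\<^sup>+y\<in>K. ennreal \<bar>f y - 0\<bar> \<partial>lebesgue)"
      by (intro nn_integral_cong) (auto split: split_indicator)
    finally show ?thesis
      using transfer[of K 0] K by (simp add: borel_compact)
  qed
  \<comment> \<open>As \<open>\<mu>\<close> may be infinite, a real bound for the radii is fixed
    below it.\<close>
  obtain m where m: "0 < m" "ereal m < \<mu>"
    using ereal_dense2[OF \<mu>] by auto
  define M where "M = enn2real (BMO_seminorm \<mu> \<Omega> f)"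
  have osc: "\<exists>c. (\<integral>\<^sup>+q\<in>cball p r. ennreal \<bar>g q - c\<bar> \<partial>lborel) \<le> ennreal M * emeasure lborel (cball p r)"
    if r: "0 < r" "r < m" "cball p r \<subseteq> \<Omega>" for p r
  proof (intro exI)
    let ?c = "mean (cball p r) f"
    let ?I = "\<integral>\<^sup>+q\<in>cball p r. ennreal \<bar>f q - ?c\<bar> \<partial>lebesgue"
    have B: "0 < emeasure lborel (cball p r)" "emeasure lborel (cball p r) < \<infinity>"
      using r unit_ball_vol_nonzero[where 'a="real ^ 'n"] by (auto simp: emeasure_cball zero_less_iff_neq_zero)
    have "ereal r < \<mu>" using r m by (meson ereal_less_eq(3) le_less_trans less_imp_le)
    then have "?I / emeasure lebesgue (cball p r) \<le> BMO_seminorm \<mu> \<Omega> f"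
      unfolding BMO_seminorm_def using r by (intro SUP_upper2[of "(p, r)"]) auto
    also have "\<dots> = ennreal M" using bmo by (simp add: M_def)
    finally have "?I / emeasure lborel (cball p r) * emeasure lborel (cball p r) \<le> ennreal M * emeasure lborel (cball p r)"
      by (intro mult_right_mono) auto
    then show "(\<integral>\<^sup>+q\<in>cball p r. ennreal \<bar>g q - ?c\<bar> \<partial>lborel) \<le> ennreal M * emeasure lborel (cball p r)"
      using B transfer[of "cball p r" ?c] r by (simp add: ennreal_divide_times ennreal_times_divide mult_divide_eq_ennreal)
  qed
  have "\<exists>\<rho>>0. (\<integral>\<^sup>+q\<in>\<Omega> \<inter> ball x \<rho>. ennreal \<bar>g q\<bar> \<partial>lborel) < \<infinity>" if x: "x \<in> closure S" for x
  proof (cases "x \<in> \<Omega>")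
    case True
    then obtain \<rho> where \<rho>: "0 < \<rho>" "cball x \<rho> \<subseteq> \<Omega>" using \<Omega>(1) open_contains_cball by blast
    have "(\<integral>\<^sup>+q\<in>\<Omega> \<inter> ball x \<rho>. ennreal \<bar>g q\<bar> \<partial>lborel) \<le> (\<integral>\<^sup>+q\<in>cball x \<rho>. ennreal \<bar>g q\<bar> \<partial>lborel)"
      by (rule nn_set_integral_mono_set) auto
    with loc[of "cball x \<rho>"] \<rho> show ?thesis by (auto intro: le_less_trans)
  next
    case False
    then have "x \<in> frontier \<Omega>"
      using x closure_mono[OF S(1)] \<Omega>(1) by (auto simp: frontier_def interior_open)
    then obtain e t \<Lambda> R where h: "lipschitz_height e x t \<Lambda>" and R: "0 < R"
      and iff: "\<And>p. p \<in> ball x R \<Longrightarrow> p \<in> \<Omega> \<longleftrightarrow> 0 < t p"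
      using C2_boundary_height[OF \<Omega>(2)] by blast
    show ?thesis
    proof (rule lipschitz_height.nn_integral_finite_near_base[OF h, where R = "min R m" and M = M])
      show "0 < min R m" "0 \<le> M" using R m by (auto simp: M_def)
    qed (use iff osc loc in auto)
  qed
  then obtain \<rho> where \<rho>: "\<And>x. x \<in> closure S \<Longrightarrow> 0 < \<rho> x"
    "\<And>x. x \<in> closure S \<Longrightarrow> (\<integral>\<^sup>+q\<in>\<Omega> \<inter> ball x (\<rho> x). ennreal \<bar>g q\<bar> \<partial>lborel) < \<infinity>"
    by metis
  have "compact (closure S)" using S(2) by simp
  then obtain D where D: "D \<subseteq> closure S" "finite D" "closure S \<subseteq> (\<Union>x\<in>D. ball x (\<rho> x))"
    by (rule compactE_image[where C = "closure S" and f = "\<lambda>x. ball x (\<rho> x)"]) (use \<rho>(1) in force)+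
  \<comment> \<open>\<open>U\<close> is open, hence a Borel set to which \<open>transfer\<close>
    applies, whereas \<open>S\<close> is an arbitrary bounded subset of
    \<open>\<Omega>\<close>.\<close>
  define U where "U = (\<Union>x\<in>D. \<Omega> \<inter> ball x (\<rho> x))"
  have "S \<subseteq> U" using D(3) S(1) closure_subset[of S] by (force simp: U_def)
  then have "(\<integral>\<^sup>+y\<in>S. ennreal \<bar>f y\<bar> \<partial>lebesgue) \<le> (\<integral>\<^sup>+y\<in>U. ennreal \<bar>f y\<bar> \<partial>lebesgue)"
    by (rule nn_set_integral_mono_set)
  also have "\<dots> = (\<integral>\<^sup>+y\<in>U. ennreal \<bar>g y\<bar> \<partial>lborel)"
  proof -
    have "open U" using \<Omega>(1) by (auto simp: U_def)
    then show ?thesis using transfer[of U 0] by (auto simp: U_def)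
  qed
  also have "\<dots> \<le> (\<integral>\<^sup>+y. (\<Sum>x\<in>D. ennreal \<bar>g y\<bar> * indicator (\<Omega> \<inter> ball x (\<rho> x)) y) \<partial>lborel)"
  proof (rule nn_integral_mono)
    fix y
    show "ennreal \<bar>g y\<bar> * indicator U y \<le> (\<Sum>x\<in>D. ennreal \<bar>g y\<bar> * indicator (\<Omega> \<inter> ball x (\<rho> x)) y)"
    proof (cases "y \<in> U")
      case True
      then obtain x where "x \<in> D" "y \<in> \<Omega> \<inter> ball x (\<rho> x)" by (auto simp: U_def)
      with True member_le_sum[of x D "\<lambda>x. ennreal \<bar>g y\<bar> * indicator (\<Omega> \<inter> ball x (\<rho> x)) y"] D(2)
      show ?thesis by simp
    qed simp
  qed
  also have "\<dots> = (\<Sum>x\<in>D. \<integral>\<^sup>+y\<in>\<Omega> \<inter> ball x (\<rho> x). ennreal \<bar>g y\<bar> \<partial>lborel)"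
    using \<Omega>(1) by (intro nn_integral_sum borel_measurable_times_ennreal) (auto intro!: borel_measurable_indicator)
  also have "\<dots> < \<infinity>"
    using \<rho>(2) D(1) by (simp add: D(2) less_top[symmetric] subset_iff)
  finally show ?thesis .
qed

section \<open>The boundary layer and the identity of the two spaces\<close>

text \<open>\<open>infdist\<close> to the empty set is 0 by convention, so no positive radius is
  admissible and the supremum is over the empty set. Hence a positive \<open>\<nu>\<close> below the
  reach forces a nonempty boundary.\<close>

lemma reach_empty: "reach ({} :: (real ^ 'n) set) = - \<infinity>"
proof -
  have "{ereal r | r. 0 < r \<and> (\<forall>x::real ^ 'n. infdist x {} < r \<longrightarrow>
     (\<exists>!y. y \<in> {} \<and> dist x y = infdist x {}))} = {}"
    by (auto simp: infdist_def)
  then show ?thesis unfolding reach_def by (simp only: Sup_empty bot_ereal_def)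
qed

text \<open>Every point of the layer is closer than \<open>\<delta>\<close> to a nearest boundary
  point. Nonemptiness provides that point; for an empty boundary the convention for
  \<open>infdist\<close> would put all of \<open>\<Omega>\<close> into the layer when
  \<open>\<delta>\<close> is positive.\<close>

lemma bounded_bnbhd:
  assumes "bounded (frontier \<Omega>)" "frontier \<Omega> \<noteq> {}"
  shows "bounded (bnbhd \<Omega> (ereal \<delta>))"
proof -
  obtain a B where B: "\<And>y. y \<in> frontier \<Omega> \<Longrightarrow> dist a y \<le> B"
    using assms(1) by (auto simp: bounded_def)
  have "dist a x \<le> B + \<delta>" if x: "x \<in> bnbhd \<Omega> (ereal \<delta>)" for x
  proof -
    obtain y where "y \<in> frontier \<Omega>" "infdist x (frontier \<Omega>) = dist x y"
      using infdist_attains_inf[OF frontier_closed assms(2)] by blast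
    with x B[of y] dist_triangle[of a x y] show ?thesis
      by (auto simp: bnbhd_def bdist_def dist_commute)
  qed
  then show ?thesis by (auto simp: bounded_def)
qed

theorem theorem9:
  fixes \<Omega> :: "(real ^ 'n) set" and \<mu> \<nu> :: ereal and r0 :: real
  assumes "bounded_domain \<Omega> \<or> exterior_domain \<Omega>"
    and "C2_boundary \<Omega>"
    and "\<forall>\<Gamma>0 \<in> components (frontier \<Omega>). fully_curved_part \<Omega> \<Gamma>0"
    and "0 < \<mu>"
    and "0 < \<nu>" and "\<nu> < reach (frontier \<Omega>)"
    and "0 < r0"
  shows "vBMO \<mu> \<nu> \<Omega> = vbmo r0 \<mu> \<nu> \<nu> \<Omega>"
proof
  show "vbmo r0 \<mu> \<nu> \<nu> \<Omega> \<subseteq> vBMO \<mu> \<nu> \<Omega>"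
    by (auto simp: vbmo_def vBMO_def less_top[symmetric] ennreal_add_eq_top)
next
  have op: "open \<Omega>" using assms(1) by (auto simp: bounded_domain_def exterior_domain_def)
  have "bounded (frontier \<Omega>)"
  proof (cases "bounded_domain \<Omega>")
    case True
    then show ?thesis by (auto simp: bounded_domain_def frontier_def intro: bounded_subset[OF bounded_closure])
  next
    case False
    then have "bounded (frontier (- \<Omega>))"
      using assms(1) by (auto simp: exterior_domain_def frontier_def intro!: bounded_subset[OF bounded_closure[OF compact_imp_bounded]])
    then show ?thesis by (simp add: frontier_complement)
  qed
  moreover have "frontier \<Omega> \<noteq> {}" using assms(5,6) reach_empty[where 'n='n] by auto
  \<comment> \<open>Lying strictly below the reach makes \<open>\<nu>\<close> finite even if the
    reach is infinite.\<close>
  moreover obtain \<delta> where \<delta>: "\<nu> = ereal \<delta>" using assms(5,6) by (cases \<nu>) auto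
  ultimately have bd: "bounded (bnbhd \<Omega> \<nu>)" by (auto intro: bounded_bnbhd)
  have "L1_ul_norm r0 (bnbhd \<Omega> \<nu>) f < \<infinity>" if "f \<in> L1_loc \<Omega>" "BMO_seminorm \<mu> \<Omega> f < \<infinity>" for f
  proof -
    \<comment> \<open>Each local integral is at most the integral over the whole layer, whatever the
      radius \<open>r0\<close>; the layer is bounded, so the latter is finite.\<close>
    have "L1_ul_norm r0 (bnbhd \<Omega> \<nu>) f \<le> (\<integral>\<^sup>+y\<in>bnbhd \<Omega> \<nu>. ennreal \<bar>f y\<bar> \<partial>lebesgue)"
      unfolding L1_ul_norm_def by (intro SUP_least nn_set_integral_mono_set) auto
    also have "\<dots> < \<infinity>"
      using op assms(2,4) that bd by (intro BMO_integrable_on_bounded) (auto simp: bnbhd_def)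
    finally show ?thesis .
  qed
  then show "vBMO \<mu> \<nu> \<Omega> \<subseteq> vbmo r0 \<mu> \<nu> \<nu> \<Omega>"
    by (auto simp: vbmo_def vBMO_def less_top[symmetric] ennreal_add_eq_top)
qed

end
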